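(* Let $n\ge 1$. There exists no $C^2$-smooth $T$-embedded disc $D^n$ in $\mathbb{R}^{2n}$; that is, there is no $C^2$-smoothly embedded $n$-dimensional disc $D^n\subset\mathbb{R}^{2n}$ such that $T_pD^n\cap T_qD^n=\emptyset$ for all distinct points $p,q\in D^n$.
   Context: A $C^1$-embedded manifold $M^n\subset\mathbb{R}^N$ is called $T$-embedded if the tangent spaces to $M$ at distinct points do not intersect. Here the tangent space $T_pM$ at $p\in M$ is regarded as the $n$-dimensional affine subspace of $\mathbb{R}^N$ passing through $p$ and tangent to $M$ at $p$. $D^n$ denotes an $n$-dimensional disc. *)

theory Defs
  imports "HOL-Analysis.Analysis"
begin

(* Derivatives are taken within S, so that the notions make sense on an open disc and, up to
   and including the boundary, on a closed disc; on both, derivatives within S are unique. *)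

definition C1_on :: "'a::euclidean_space set \<Rightarrow> ('a \<Rightarrow> 'b::real_normed_vector) \<Rightarrow> bool" where
  "C1_on S f \<longleftrightarrow>
     (\<exists>f' :: 'a \<Rightarrow> 'a \<Rightarrow>\<^sub>L 'b.
        (\<forall>x\<in>S. (f has_derivative blinfun_apply (f' x)) (at x within S)) \<and>
        continuous_on S f')"

definition C2_on :: "'a::euclidean_space set \<Rightarrow> ('a \<Rightarrow> 'b::real_normed_vector) \<Rightarrow> bool" where
  "C2_on S f \<longleftrightarrow>
     (\<exists>f' :: 'a \<Rightarrow> 'a \<Rightarrow>\<^sub>L 'b.
        (\<forall>x\<in>S. (f has_derivative blinfun_apply (f' x)) (at x within S)) \<and>
        C1_on S f')"

definition C1_embedding_on ::
    "'a::euclidean_space set \<Rightarrow> ('a \<Rightarrow> 'b::euclidean_space) \<Rightarrow> bool" where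
  "C1_embedding_on S f \<longleftrightarrow>
     C1_on S f \<and>
     (\<forall>x\<in>S. inj (frechet_derivative f (at x within S))) \<and>
     (\<exists>g. homeomorphism S (f ` S) f g)"

(* The affine tangent space at the point f x of the embedded manifold f ` S. *)

definition affine_tangent_space ::
    "'a::euclidean_space set \<Rightarrow> ('a \<Rightarrow> 'b::euclidean_space) \<Rightarrow> 'a \<Rightarrow> 'b set" where
  "affine_tangent_space S f x =
     {f x + v | v. v \<in> range (frechet_derivative f (at x within S))}"

definition T_embedding_on ::
    "'a::euclidean_space set \<Rightarrow> ('a \<Rightarrow> 'b::euclidean_space) \<Rightarrow> bool" where
  "T_embedding_on S f \<longleftrightarrow>
     C1_embedding_on S f \<and>
     (\<forall>x\<in>S. \<forall>y\<in>S. x \<noteq> y \<longrightarrow>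
        affine_tangent_space S f x \<inter> affine_tangent_space S f y = {})"

end

theory Submission imports Defs begin

text \<open>
  The proof plays invariance of domain against Sard's theorem, applied to the map
  \<open>F(x, w) = f x + f'(x) w\<close> that lays the tangent bundle of the open disc out in
  \<open>\<real>\<^sup>2\<^sup>n\<close>.  For a \<open>T\<close>-embedding \<open>F\<close> is injective: points over distinct base points are
  separated because the tangent spaces are disjoint, points over the same base point because
  \<open>f'(x)\<close> is injective.  As source and target both have dimension \<open>2n\<close>, the image of \<open>F\<close> is
  open, and since \<open>f\<close> is \<open>C\<^sup>2\<close>, \<open>F\<close> is differentiable; so by Sard's theorem the derivative of
  \<open>F\<close> is injective at some point (\<open>injective_map_has_regular_point\<close>).

  On the other hand, \<open>F\<close> is singular everywhere.  Two disjoint affine \<open>n\<close>-planes in \<open>\<real>\<^sup>2\<^sup>n\<close>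
  cannot have complementary directions, so \<open>(v, u) \<mapsto> f'(x) v + f'(y) u\<close> is singular whenever
  \<open>x \<noteq> y\<close>.  Column operations turn it into \<open>(v, u) \<mapsto> f'(x) v + ((f'(y) - f'(x)) / t) u\<close>;
  with \<open>y = x + t w\<close> and \<open>t \<rightarrow> 0\<close>, the map \<open>(v, u) \<mapsto> f'(x) v + f''(x)(w, u)\<close> is singular
  too (\<open>singular_second_derivative\<close>).  Because \<open>f''(x)\<close> is symmetric
  (\<open>second_derivative_symmetric\<close>), this is, again up to column operations, the derivative
  \<open>(v, u) \<mapsto> f'(x) v + f''(x)(v, w) + f'(x) u\<close> of \<open>F\<close> at \<open>(x, w)\<close>.
\<close>

section \<open>Symmetry of the second derivative\<close>

text \<open>
  The derivative need only exist near \<open>x\<close> and be differentiable at the single point \<open>x\<close>.  The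
  second difference \<open>\<Delta> v w t\<close>, which is symmetric in \<open>v\<close> and \<open>w\<close>, is approximated by
  \<open>t\<^sup>2 H(v) w\<close> up to \<open>o(t\<^sup>2)\<close>, by a mean value estimate in the direction \<open>w\<close>.
\<close>
lemma second_derivative_symmetric:
  fixes f :: "'a::real_normed_vector \<Rightarrow> 'b::real_normed_vector"
    and f' :: "'a \<Rightarrow> 'a \<Rightarrow>\<^sub>L 'b"
  assumes "open S" "x \<in> S"
    and f: "\<And>y. y \<in> S \<Longrightarrow> (f has_derivative blinfun_apply (f' y)) (at y)"
    and H: "(f' has_derivative H) (at x)"
  shows "blinfun_apply (H v) w = blinfun_apply (H w) v"
proof -
  interpret H: bounded_linear H using H by (rule has_derivative_bounded_linear)
  define \<Delta> where "\<Delta> v w t = f (x + t *\<^sub>R v + t *\<^sub>R w) - f (x + t *\<^sub>R v) - f (x + t *\<^sub>R w) + f x" for v w t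
  have key: "\<exists>d>0. \<forall>t. 0 < t \<and> t < d \<longrightarrow>
      norm (\<Delta> v w t - t\<^sup>2 *\<^sub>R H v w) \<le> e * t\<^sup>2" if "e > 0" for e :: real and v w
  proof -
    define K where "K = norm v + norm w + 1"
    have K: "K > 0" "norm v + norm w \<le> K" "norm w \<le> K"
      unfolding K_def by (auto intro: add_nonneg_pos)
    \<comment> \<open>Two remainders, each at most \<open>e' t K\<close> and applied to a vector of norm at most \<open>K\<close>, give \<open>e t\<close>.\<close>
    define e' where "e' = e / (2 * K\<^sup>2)"
    have "e' > 0" using that K by (simp add: e'_def)
    obtain d1 where d1: "d1 > 0"
      "\<And>y. norm (y - x) < d1 \<Longrightarrow> norm (f' y - f' x - H (y - x)) \<le> e' * norm (y - x)"
      using H \<open>e' > 0\<close> unfolding has_derivative_at_alt by blast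
    obtain d2 where d2: "d2 > 0" "ball x d2 \<subseteq> S" using assms(1,2) openE by blast
    define d where "d = min d1 d2 / K"
    have "d > 0" using d1 d2 K by (simp add: d_def)
    moreover have "norm (\<Delta> v w t - t\<^sup>2 *\<^sub>R H v w) \<le> e * t\<^sup>2" if t: "0 < t" "t < d" for t
    proof -
      have tK: "t * K < d1" "t * K < d2" using t K by (auto simp: d_def field_simps)
      have near: "norm (r *\<^sub>R v + s *\<^sub>R w) \<le> t * K"
        if "r \<in> {0..t}" "s \<in> {0..t}" for r s
      proof -
        have "norm (r *\<^sub>R v + s *\<^sub>R w) \<le> r * norm v + s * norm w"
          using that by (intro norm_triangle_le) auto
        also have "\<dots> \<le> t * norm v + t * norm w"
          using that by (intro add_mono mult_right_mono) auto
        also have "\<dots> \<le> t * K" using K t by (simp flip: distrib_left)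
        finally show ?thesis .
      qed
      define \<phi> where "\<phi> s = f (x + t *\<^sub>R v + s *\<^sub>R w) - f (x + s *\<^sub>R w) - s *\<^sub>R t *\<^sub>R H v w" for s
      define \<phi>' where "\<phi>' s = f' (x + t *\<^sub>R v + s *\<^sub>R w) w - f' (x + s *\<^sub>R w) w - t *\<^sub>R H v w" for s
      have inS: "x + r *\<^sub>R v + s *\<^sub>R w \<in> S" if "r \<in> {0..t}" "s \<in> {0..t}" for r s
        using d2 near[OF that] tK by (auto simp: subset_iff dist_norm add.assoc norm_minus_commute)
      have der: "(\<phi> has_derivative (\<lambda>u. u *\<^sub>R \<phi>' s)) (at s within {0..t})" if "s \<in> {0..t}" for s
      proof -
        have 1: "((\<lambda>s. f (x + r *\<^sub>R v + s *\<^sub>R w)) has_derivative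
            (\<lambda>u. f' (x + r *\<^sub>R v + s *\<^sub>R w) (u *\<^sub>R w))) (at s within {0..t})" if "r \<in> {0..t}" for r
          by (rule has_derivative_compose[of "\<lambda>s. x + r *\<^sub>R v + s *\<^sub>R w" _ _ _ f])
            (auto intro!: derivative_eq_intros f inS that \<open>s \<in> _\<close>)
        have 2: "((\<lambda>s. s *\<^sub>R t *\<^sub>R H v w) has_derivative (\<lambda>u. u *\<^sub>R t *\<^sub>R H v w)) (at s within {0..t})"
          by (rule bounded_linear_imp_has_derivative) (rule bounded_linear_scaleR_left)
        have 0: "0 \<in> {0..t}" "t \<in> {0..t}" using t by auto
        show ?thesis unfolding \<phi>_def
          by (rule has_derivative_eq_rhs[OF has_derivative_diff[OF has_derivative_diff
                [OF 1[OF 0(2)] 1[OF 0(1), unfolded scaleR_zero_left add_0_right]] 2]])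
            (simp add: \<phi>'_def blinfun.scaleR_right scaleR_diff_right fun_eq_iff)
      qed
      \<comment> \<open>The linear parts of \<open>f'\<close> cancel against \<open>t H(v) w\<close>, so only the two remainders \<open>R\<close> contribute.\<close>
      have bd: "norm (\<phi>' s) \<le> e * t" if s: "s \<in> {0..t}" for s
      proof -
        define R where "R y = f' y - f' x - H (y - x)" for y
        have R: "norm (R (x + r *\<^sub>R v + s *\<^sub>R w)) \<le> e' * (t * K)" if "r \<in> {0..t}" for r
        proof -
          have "norm (R (x + r *\<^sub>R v + s *\<^sub>R w)) \<le> e' * norm (r *\<^sub>R v + s *\<^sub>R w)"
            using d1(2)[of "x + r *\<^sub>R v + s *\<^sub>R w"] near[OF that s] tK by (simp add: R_def add.assoc)
          also have "\<dots> \<le> e' * (t * K)" using near[OF that s] \<open>e' > 0\<close> by (intro mult_left_mono) auto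
          finally show ?thesis .
        qed
        have "\<phi>' s = (R (x + t *\<^sub>R v + s *\<^sub>R w) - R (x + s *\<^sub>R w)) w"
          by (simp add: \<phi>'_def R_def H.add H.scaleR H.diff blinfun.bilinear_simps add.assoc)
        also have "norm \<dots> \<le> norm (R (x + t *\<^sub>R v + s *\<^sub>R w) - R (x + s *\<^sub>R w)) * norm w"
          by (rule norm_blinfun)
        also have "\<dots> \<le> (e' * (t * K) + e' * (t * K)) * K"
          using R[of t] R[of 0] t K \<open>e' > 0\<close>
          by (intro mult_mono order_trans[OF norm_triangle_ineq4] add_mono) auto
        also have "\<dots> = e * t" using K by (simp add: e'_def field_simps power2_eq_square)
        finally show ?thesis .
      qed
      have "norm (\<phi> t - \<phi> 0) \<le> (e * t) * norm (t - 0)"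
      proof (rule differentiable_bound[of "{0..t}" \<phi> "\<lambda>s u. u *\<^sub>R \<phi>' s"])
        show "onorm (\<lambda>u. u *\<^sub>R \<phi>' s) \<le> e * t" if "s \<in> {0..t}" for s
          by (rule onorm_le) (use bd[OF that] in \<open>simp add: mult.commute mult_left_mono\<close>)
      qed (use der t in auto)
      moreover have "\<phi> t - \<phi> 0 = \<Delta> v w t - t\<^sup>2 *\<^sub>R H v w"
        by (simp add: \<phi>_def \<Delta>_def power2_eq_square)
      ultimately show ?thesis using t by (simp add: power2_eq_square mult.assoc)
    qed
    ultimately show ?thesis by blast
  qed
  have "norm (H v w - H w v) \<le> e" if "e > 0" for e
  proof -
    have "e / 2 > 0" using that by simp
    obtain d1 where d1: "d1 > 0"
      "\<And>t. 0 < t \<Longrightarrow> t < d1 \<Longrightarrow> norm (\<Delta> v w t - t\<^sup>2 *\<^sub>R H v w) \<le> (e/2) * t\<^sup>2"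
      using key[OF \<open>e / 2 > 0\<close>, of v w] by blast
    obtain d2 where d2: "d2 > 0"
      "\<And>t. 0 < t \<Longrightarrow> t < d2 \<Longrightarrow> norm (\<Delta> w v t - t\<^sup>2 *\<^sub>R H w v) \<le> (e/2) * t\<^sup>2"
      using key[OF \<open>e / 2 > 0\<close>, of w v] by blast
    define t where "t = min d1 d2 / 2"
    have t: "0 < t" "t < d1" "t < d2" using d1(1) d2(1) by (auto simp: t_def)
    have sym: "\<Delta> w v t = \<Delta> v w t" by (simp add: \<Delta>_def algebra_simps)
    have "t\<^sup>2 *\<^sub>R (H v w - H w v) = (\<Delta> w v t - t\<^sup>2 *\<^sub>R H w v) - (\<Delta> v w t - t\<^sup>2 *\<^sub>R H v w)"
      by (simp add: sym algebra_simps)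
    then have "t\<^sup>2 * norm (H v w - H w v) = norm \<dots>"
      by (metis abs_of_nonneg norm_scaleR zero_le_power2)
    also have "\<dots> \<le> (e/2) * t\<^sup>2 + (e/2) * t\<^sup>2"
      using d1(2)[OF t(1,2)] d2(2)[OF t(1,3)] norm_triangle_ineq4 order_trans add_mono by (smt (verit, best))
    finally have "t\<^sup>2 * norm (H v w - H w v) \<le> t\<^sup>2 * e" by (simp add: mult.commute)
    then show ?thesis using t by simp
  qed
  then have "norm (H v w - H w v) \<le> 0" by (rule field_le_epsilon) simp
  then show ?thesis by simp
qed

section \<open>Regular points of injective maps\<close>

text \<open>
  An injective map between spaces of equal dimension that is differentiable on a nonempty open
  set has a point with injective derivative: its image is open, whereas the image of a set of
  singular points is negligible.  The type \<open>'k\<close> supplies a well-ordered set of coordinates, on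
  which Sard's theorem depends.
\<close>
lemma injective_map_has_regular_point:
  fixes F :: "'a::euclidean_space \<Rightarrow> 'b::euclidean_space"
  assumes dim: "DIM('a) = CARD('k::{finite,wellorder})" "DIM('b) = CARD('k)"
    and S: "open S" "S \<noteq> {}" "inj_on F S"
    and F: "\<And>x. x \<in> S \<Longrightarrow> (F has_derivative F' x) (at x)"
  obtains x where "x \<in> S" "inj (F' x)"
proof (rule ccontr)
  assume "\<not> thesis"
  then have sing: "\<not> inj (F' x)" if "x \<in> S" for x
    using that \<open>\<And>x. x \<in> S \<Longrightarrow> inj (F' x) \<Longrightarrow> thesis\<close> by blast
  obtain p :: "real^'k::{finite,wellorder} \<Rightarrow> 'a" and p' where p: "linear p" "linear p'"
      "\<And>x. p' (p x) = x" "\<And>x. p (p' x) = x"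
    by (rule isomorphisms_UNIV_UNIV[where 'M="real^'k::{finite,wellorder}" and 'N='a]) (use dim in auto)
  obtain q :: "'b \<Rightarrow> real^'k::{finite,wellorder}" and q' where q: "linear q" "linear q'"
      "\<And>x. q' (q x) = x" "\<And>x. q (q' x) = x"
    by (rule isomorphisms_UNIV_UNIV[where 'M='b and 'N="real^'k::{finite,wellorder}"]) (use dim in auto)
  define G where "G = q \<circ> F \<circ> p"
  define U where "U = p -` S"
  have "bounded_linear p" "bounded_linear q"
    using p(1) q(1) by (auto simp: linear_conv_bounded_linear)
  have G: "(G has_derivative q \<circ> F' (p u) \<circ> p) (at u)" if "u \<in> U" for u
    unfolding G_def using that \<open>bounded_linear p\<close> \<open>bounded_linear q\<close>
    by (intro diff_chain_at bounded_linear_imp_has_derivative)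
      (auto simp: U_def intro!: F)
  have "open U"
    unfolding U_def using S(1) p(1)
    by (intro open_vimage linear_continuous_on) (auto simp: linear_conv_bounded_linear)
  moreover have "continuous_on U G"
    using G has_derivative_continuous continuous_at_imp_continuous_on by blast
  moreover have "inj_on G U"
  proof (rule inj_onI)
    fix u v assume uv: "u \<in> U" "v \<in> U" "G u = G v"
    then have "F (p u) = F (p v)" unfolding G_def comp_def by (metis q(3))
    then have "p u = p v" using S(3) uv by (auto simp: U_def dest: inj_onD)
    then show "u = v" by (metis p(3))
  qed
  ultimately have "open (G ` U)" by (intro invariance_of_domain_gen) auto
  moreover have "G ` U \<noteq> {}" using S(2) p(4) unfolding U_def by (metis empty_is_image ex_in_conv vimageI2)
  ultimately have "\<not> negligible (G ` U)" by (rule open_not_negligible)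
  moreover have "negligible (G ` U)"
  proof (rule baby_Sard)
    show "(G has_derivative q \<circ> F' (p u) \<circ> p) (at u within U)" if "u \<in> U" for u
      using G[OF that] by (rule has_derivative_at_withinI)
    show "rank (matrix (q \<circ> F' (p u) \<circ> p)) < CARD('k)" if "u \<in> U" for u
    proof -
      have "p u \<in> S" using that by (simp add: U_def)
      obtain a b where ab: "a \<noteq> b" "F' (p u) a = F' (p u) b"
        using sing[OF \<open>p u \<in> S\<close>] by (auto simp: inj_def)
      have "(q \<circ> F' (p u) \<circ> p) (p' a) = (q \<circ> F' (p u) \<circ> p) (p' b)"
        using ab(2) p(4) by simp
      moreover have "p' a \<noteq> p' b" using ab(1) p(4) by metis
      ultimately have "\<not> inj (q \<circ> F' (p u) \<circ> p)" by (metis injD)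
      then show ?thesis
        using has_derivative_linear[OF G[OF that]]
        by (simp add: less_rank_noninjective)
    qed
  qed simp
  ultimately show False by blast
qed

section \<open>Nontransversality in the limit\<close>

lemma kernel_of_approximate_kernel:
  fixes A :: "'a::euclidean_space \<Rightarrow> 'b::euclidean_space"
  assumes A: "linear A"
    and near: "\<And>e. e > 0 \<Longrightarrow> \<exists>x. x \<noteq> 0 \<and> norm (A x) \<le> e * norm x"
  shows "\<exists>x. x \<noteq> 0 \<and> A x = 0"
proof (rule ccontr)
  assume "\<not> ?thesis"
  then have "inj A" using A by (metis linear_injective_0)
  then obtain B where B: "B > 0" "\<And>x. B * norm x \<le> norm (A x)"
    using linear_inj_bounded_below_pos[OF A] by blast
  obtain x where x: "x \<noteq> 0" "norm (A x) \<le> (B/2) * norm x" using near[of "B/2"] B(1) by auto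
  then have "B * norm x \<le> (B/2) * norm x" using B(2)[of x] by linarith
  then show False using B(1) x(1) by simp
qed

text \<open>
  If the ranges of \<open>A\<close> and \<open>B\<close> together do not span a target of twice the dimension of their
  common domain, then, for reasons of dimension, \<open>A\<close> and \<open>B\<close> satisfy a nontrivial relation.
\<close>
lemma nontransversal_kernel:
  fixes A B :: "'a::euclidean_space \<Rightarrow> 'b::euclidean_space"
  assumes "linear A" "linear B" and dim: "DIM('b) = 2 * DIM('a)"
    and c: "\<And>v w. A v + B w \<noteq> c"
  obtains v w where "(v, w) \<noteq> (0, 0)" "A v + B w = 0"
proof -
  define L where "L = (\<lambda>(v, w). A v + B w)"
  have L: "linear L"
    unfolding L_def
    by (rule linearI) (auto simp: linear_add[OF assms(1)] linear_add[OF assms(2)]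
        linear_scale[OF assms(1)] linear_scale[OF assms(2)] algebra_simps)
  have "\<not> inj L"
  proof
    assume "inj L"
    then have "dim (range L) = DIM('b)"
      using dim_image_eq[OF L, of UNIV] dim by simp
    then have "range L = UNIV"
      using dim_eq_full[of "range L"] L span_eq_iff linear_subspace_image subspace_UNIV by metis
    then have "c \<in> range L" by simp
    then show False using c by (auto simp: L_def)
  qed
  then obtain p where "L p = 0" "p \<noteq> 0" using L linear_injective_0 by blast
  then show ?thesis using that[of "fst p" "snd p"] by (auto simp: L_def case_prod_beta prod_eq_iff)
qed

text \<open>
  Nontransversality of \<open>f'(x)\<close> with \<open>f'(y)\<close> for all \<open>y\<close> near \<open>x\<close> passes to the derivative \<open>H\<close>
  of \<open>f'\<close> at \<open>x\<close>, in each direction \<open>w\<close>.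
\<close>
lemma singular_second_derivative:
  fixes f' :: "'a::euclidean_space \<Rightarrow> 'a \<Rightarrow>\<^sub>L 'b::euclidean_space"
  assumes S: "open S" "x \<in> S" and dim: "DIM('b) = 2 * DIM('a)"
    and H: "(f' has_derivative H) (at x)"
    and c: "\<And>y. y \<in> S \<Longrightarrow> y \<noteq> x \<Longrightarrow> \<exists>c. \<forall>v w. f' x v + f' y w \<noteq> c"
  obtains v u where "(v, u) \<noteq> (0, 0)" "f' x v + H w u = 0"
proof (cases "w = 0")
  case True
  obtain b :: 'a where "b \<in> Basis" using nonempty_Basis by blast
  moreover have "H 0 = 0" using H has_derivative_bounded_linear linear_simps(3) by blast
  ultimately show ?thesis using that[of 0 b] True nonzero_Basis[of b] by (auto simp: blinfun.bilinear_simps)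
next
  case False
  interpret H: bounded_linear H using H by (rule has_derivative_bounded_linear)
  have "\<exists>p. p \<noteq> 0 \<and> (\<lambda>(v, u). f' x v + H w u) p = 0"
  proof (rule kernel_of_approximate_kernel)
    show "linear (\<lambda>(v, u). f' x v + H w u)"
      by (rule linearI) (auto simp: blinfun.bilinear_simps algebra_simps)
    fix e :: real assume "e > 0"
    define e' where "e' = e / norm w"
    have "e' > 0" using \<open>e > 0\<close> False by (simp add: e'_def)
    then obtain d1 where d1: "d1 > 0"
      "\<And>y. norm (y - x) < d1 \<Longrightarrow> norm (f' y - f' x - H (y - x)) \<le> e' * norm (y - x)"
      using H unfolding has_derivative_at_alt by blast
    obtain d2 where d2: "d2 > 0" "ball x d2 \<subseteq> S" using S openE by blast
    define t where "t = min d1 d2 / (2 * norm w)"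
    have t: "t > 0" "t * norm w < d1" "t * norm w < d2"
      using d1(1) d2(1) False by (auto simp: t_def)
    define y where "y = x + t *\<^sub>R w"
    have y: "y \<in> S" "y \<noteq> x"
      using t d2(2) False by (auto simp: y_def subset_iff dist_norm)
    obtain c where "\<And>v u. f' x v + f' y u \<noteq> c" using c[OF y] by blast
    then obtain v u where vu: "(v, u) \<noteq> (0, 0)" "f' x v + f' y u = 0"
      using nontransversal_kernel[of "blinfun_apply (f' x)" "blinfun_apply (f' y)" c] dim
      by (metis blinfun.bounded_linear_right bounded_linear.linear)
    \<comment> \<open>The column operations send the relation \<open>(v, u)\<close> to \<open>(v + u, t u)\<close>.\<close>
    have eq: "f' x (v + u) + H w (t *\<^sub>R u) = - ((f' y - f' x - H (y - x)) u)"
      using vu(2) by (simp add: y_def H.scaleR blinfun.bilinear_simps algebra_simps)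
    have "norm (f' x (v + u) + H w (t *\<^sub>R u)) \<le> norm (f' y - f' x - H (y - x)) * norm u"
      unfolding eq norm_minus_cancel by (rule norm_blinfun)
    also have "\<dots> \<le> (e' * norm (y - x)) * norm u"
      using t by (intro mult_right_mono d1(2)) (auto simp: y_def)
    also have "\<dots> = e * norm (t *\<^sub>R u)" using t False by (simp add: y_def e'_def)
    also have "\<dots> \<le> e * norm (v + u, t *\<^sub>R u)"
      using \<open>e > 0\<close> norm_snd_le[where y="t *\<^sub>R u" and x="v + u"] by (intro mult_left_mono) auto
    finally show "\<exists>p. p \<noteq> 0 \<and> norm ((\<lambda>(v, u). f' x v + H w u) p) \<le> e * norm p"
      using vu(1) t(1) by (intro exI[of _ "(v + u, t *\<^sub>R u)"]) (auto simp: zero_prod_def)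
  qed
  then show ?thesis using that by (auto simp: zero_prod_def)
qed

section \<open>The tangent bundle map of a disc\<close>

theorem theorem1:
  fixes D :: "(real ^ 'n) set"
  assumes "CARD('m) = 2 * CARD('n)"
    and "D = ball 0 1 \<or> D = cball 0 1"
  shows "\<not> (\<exists>f :: real ^ 'n \<Rightarrow> real ^ 'm. C2_on D f \<and> T_embedding_on D f)"
proof
  assume "\<exists>f :: real ^ 'n \<Rightarrow> real ^ 'm. C2_on D f \<and> T_embedding_on D f"
  then obtain f :: "real ^ 'n \<Rightarrow> real ^ 'm" where "C2_on D f" and T: "T_embedding_on D f"
    by blast
  obtain f' f'' where
      f0: "\<And>x. x \<in> D \<Longrightarrow> (f has_derivative blinfun_apply (f' x)) (at x within D)" and
      f1: "\<And>x. x \<in> D \<Longrightarrow> (f' has_derivative blinfun_apply (f'' x)) (at x within D)"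
    using \<open>C2_on D f\<close> unfolding C2_on_def C1_on_def by blast
  \<comment> \<open>On the open ball the derivatives within \<open>D\<close> are ordinary derivatives, for either choice of \<open>D\<close>.\<close>
  define S :: "(real ^ 'n) set" where "S = ball 0 1"
  have S: "open S" "S \<subseteq> D" "0 \<in> S" using assms(2) by (auto simp: S_def)
  have at_S: "at x within D = at x" if "x \<in> S" for x
    using S that by (meson at_within_interior interior_maximal subsetD)
  have f: "(f has_derivative blinfun_apply (f' x)) (at x)"
    and f': "(f' has_derivative blinfun_apply (f'' x)) (at x)" if "x \<in> S" for x
    using f0[of x] f1[of x] at_S[OF that] that S(2) by auto
  have fr: "frechet_derivative f (at x within D) = f' x" if "x \<in> S" for x
    using frechet_derivative_at[OF f[OF that]] at_S[OF that] by simp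
  have inj: "inj (blinfun_apply (f' x))" if "x \<in> S" for x
    using T that S(2) unfolding T_embedding_on_def C1_embedding_on_def
    by (auto simp flip: fr[OF that])
  have disj: "f x + f' x v \<noteq> f y + f' y w" if "x \<in> S" "y \<in> S" "x \<noteq> y" for x y v w
  proof
    assume "f x + f' x v = f y + f' y w"
    then have "f x + f' x v \<in> affine_tangent_space D f x \<inter> affine_tangent_space D f y"
      unfolding affine_tangent_space_def fr[OF that(1)] fr[OF that(2)] by blast
    then show False
      using T that S(2) unfolding T_embedding_on_def by blast
  qed
  define F where "F = (\<lambda>(x, w). f x + f' x w)"
  define F' where "F' = (\<lambda>(x, w) (v, u). f' x v + (f'' x v w + f' x u))"
  have dim: "DIM(real ^ 'm) = 2 * DIM(real ^ 'n)" using assms(1) by simp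
  \<comment> \<open>The type \<open>'n bit0\<close> is a well-ordered type with twice as many elements as \<open>'n\<close>.\<close>
  obtain p where p: "p \<in> S \<times> UNIV" "inj (F' p)"
  proof (rule injective_map_has_regular_point[where 'k="'n bit0" and F=F and F'=F' and S="S \<times> UNIV"])
    show "DIM((real ^ 'n) \<times> (real ^ 'n)) = CARD('n bit0)" "DIM(real ^ 'm) = CARD('n bit0)"
      using assms(1) by auto
    show "open (S \<times> (UNIV :: (real ^ 'n) set))" "S \<times> (UNIV :: (real ^ 'n) set) \<noteq> {}"
      using S by (auto intro: open_Times)
    show "inj_on F (S \<times> UNIV)"
      using disj inj by (fastforce simp: F_def inj_on_def)
    show "(F has_derivative F' z) (at z)" if "z \<in> S \<times> UNIV" for z
    proof -
      have z: "fst z \<in> S" using that by auto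
      have fst': "(fst has_derivative fst) (at z)"
        by (rule bounded_linear_imp_has_derivative) (rule bounded_linear_fst)
      have snd': "(snd has_derivative snd) (at z)"
        by (rule bounded_linear_imp_has_derivative) (rule bounded_linear_snd)
      show ?thesis
        unfolding F_def F'_def case_prod_beta
        using has_derivative_add[OF has_derivative_compose[OF fst' f[OF z]]
          blinfun.FDERIV[OF has_derivative_compose[OF fst' f'[OF z]] snd']]
        by (simp add: add.commute)
    qed
  qed
  obtain x w where xw: "p = (x, w)" "x \<in> S" using p(1) by auto
  obtain v u where vu: "(v, u) \<noteq> (0, 0)" "f' x v + f'' x w u = 0"
  proof (rule singular_second_derivative[OF S(1) xw(2) dim f'[OF xw(2)]])
    show "\<exists>c. \<forall>v w. f' x v + f' y w \<noteq> c" if "y \<in> S" "y \<noteq> x" for y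
    proof (intro exI allI notI)
      fix v w assume "f' x v + f' y w = f y - f x"
      then have "f x + f' x v = f y + f' y (- w)"
        by (simp add: blinfun.minus_right algebra_simps)
      then show False using disj xw(2) that by blast
    qed
  qed
  \<comment> \<open>By symmetry, \<open>(u, v - u)\<close> lies in the kernel of \<open>F' p\<close>.\<close>
  have "f'' x w u = f'' x u w"
    using second_derivative_symmetric[OF S(1) xw(2) f f'[OF xw(2)]] .
  then have "F' p (u, v - u) = 0" "F' p (0, 0) = 0"
    using vu(2) by (simp_all add: F'_def xw(1) blinfun.bilinear_simps algebra_simps)
  then have "(u, v - u) = (0, 0)" using injD[OF p(2)] by metis
  then show False using vu(1) by simp
qed

end
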